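(* Let $0\le K\le N$ and $1\le T\le 2^N$ be integers. For an ORB-type GRAND algorithm with ordered list of distinct error patterns $\underline{e}(1),\dots,\underline{e}(T)$ and permutation law $\pi_{\underline{y}}$, over the random code ensemble, the probability $P_{\mathrm{stop}}(t)$ that the codeword tester stops after exactly $t$ tests is $$P_{\mathrm{stop}}(t)=p_t(1-f(t))+\left(1-\sum_{i=1}^{t}p_i\right)(f(t+1)-f(t)),\qquad t=1,\dots,T-1,$$ $$P_{\mathrm{stop}}(T)=\left(1-\sum_{i=1}^{T-1}p_i\right)(1-f(T)).$$
   Context: Channel: $q_0,q_1$ are probability densities on $\mathbb{R}$; when $\underline{w}\in\mathbb{F}_2^N$ is sent, the output $\underline{Y}\in\mathbb{R}^N$ has density $\prod_i q_{w_i}(y_i)$. The log-likelihood ratios are $\ell_i=\log(q_0(y_i)/q_1(y_i))$ and the hard decision is $\theta(\underline{y})\in\mathbb{F}_2^N$ with $\theta(\underline y)_i=\mathbf{1}(\ell_i<0)$. ORB-type GRAND: an ordered list of $T$ distinct vectors $\underline{e}(1),\dots,\underline{e}(T)\in\mathbb{F}_2^N$ (error patterns) is fixed in advance, independent of $\underline{Y}$; a permutation law assigns (measurably) to each $\underline{y}\in\mathbb{R}^N$ a permutation $\pi_{\underline{y}}$ of the coordinates $\{1,\dots,N\}$, acting on vectors of $\mathbb{F}_2^N$ by permuting coordinates. Given $\underline{y}$ and a codebook $\mathcal{C}$, the decoder tests for $t=1,2,\dots,T$ whether $\theta(\underline{y})\oplus\pi_{\underline{y}}(\underline{e}(t))\in\mathcal{C}$;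 it stops at the first $t$ for which this holds and outputs that codeword; if no $t\le T$ works, it stops after $T$ tests and declares failure. Random code ensemble: the codewords $\underline{W}(1),\dots,\underline{W}(2^K)$ are drawn sequentially, uniformly without replacement, from $\mathbb{F}_2^N$; the transmitted message index is uniform on $\{1,\dots,2^K\}$ and independent of the codebook, and given the codebook and index the output $\underline{Y}$ depends only on the transmitted codeword. $p_t=\mathbf{E}_{\underline{Y}}[P_{\underline{W}|\underline{Y}}(\theta(\underline{Y})\oplus\pi_{\underline{Y}}(\underline{e}(t))\mid\underline{Y})]$, where $\underline{W}$ is the transmitted codeword (uniform on $\mathbb{F}_2^N$ after averaging over the ensemble) and $P_{\underline{W}|\underline{Y}}$ is the ensemble-averaged posterior. The pre-target codeword-hit probability is $f(t)=1-\prod_{i=1}^{t-1}\frac{2^N-2^K+1-i}{2^N-i}$ (so $f(1)=0$). *)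

theory Defs
  imports "HOL-Probability.Probability" "HOL-Combinatorics.Permutations" "HOL-Library.Z2"
begin

text \<open>Vectors are extensional functions on \<open>{1..N}\<close>, so that \<open>N = 0\<close> is covered as well.\<close>

definition F2 :: "nat \<Rightarrow> (nat \<Rightarrow> bit) set" where
  "F2 N = {1..N} \<rightarrow>\<^sub>E UNIV"

definition xor_vec :: "nat \<Rightarrow> (nat \<Rightarrow> bit) \<Rightarrow> (nat \<Rightarrow> bit) \<Rightarrow> (nat \<Rightarrow> bit)" where
  "xor_vec N u v = (\<lambda>i\<in>{1..N}. u i + v i)"

definition permute_vec :: "nat \<Rightarrow> (nat \<Rightarrow> nat) \<Rightarrow> (nat \<Rightarrow> bit) \<Rightarrow> (nat \<Rightarrow> bit)" where
  "permute_vec N p v = (\<lambda>i\<in>{1..N}. v (inv p i))"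

text \<open>The log-likelihood ratio is extended-real valued, since \<open>ln 0 = 0\<close> and \<open>x / 0 = 0\<close> in HOL
  would give the wrong sign where one of the two densities vanishes. Where both vanish
  (a null event for the channel output), its value is \<open>0\<close>.\<close>

definition llr :: "(bit \<Rightarrow> real \<Rightarrow> real) \<Rightarrow> real \<Rightarrow> ereal" where
  "llr q x =
    (if q 0 x = 0 \<and> q 1 x = 0 then 0
     else if q 0 x = 0 then - \<infinity>
     else if q 1 x = 0 then \<infinity>
     else ereal (ln (q 0 x / q 1 x)))"

definition hard_decision :: "(bit \<Rightarrow> real \<Rightarrow> real) \<Rightarrow> nat \<Rightarrow> (nat \<Rightarrow> real) \<Rightarrow> (nat \<Rightarrow> bit)" where
  "hard_decision q N y = (\<lambda>i\<in>{1..N}. if llr q (y i) < 0 then 1 else 0)"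

definition likelihood :: "(bit \<Rightarrow> real \<Rightarrow> real) \<Rightarrow> nat \<Rightarrow> (nat \<Rightarrow> bit) \<Rightarrow> (nat \<Rightarrow> real) \<Rightarrow> real" where
  "likelihood q N w y = (\<Prod>i\<in>{1..N}. q (w i) (y i))"

definition channel :: "(bit \<Rightarrow> real \<Rightarrow> real) \<Rightarrow> nat \<Rightarrow> (nat \<Rightarrow> bit) \<Rightarrow> (nat \<Rightarrow> real) measure" where
  "channel q N w =
    density (PiM {1..N} (\<lambda>_. lborel)) (\<lambda>y. ennreal (likelihood q N w y))"

primrec draw_without_replacement :: "nat \<Rightarrow> 'a set \<Rightarrow> 'a list pmf" where
  "draw_without_replacement 0 A = return_pmf []"
| "draw_without_replacement (Suc n) A =
    bind_pmf (pmf_of_set A) (\<lambda>x.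
      map_pmf (\<lambda>xs. x # xs) (draw_without_replacement n (A - {x})))"

text \<open>Codebook together with the (zero-based) index of the transmitted message.\<close>

definition ensemble :: "nat \<Rightarrow> nat \<Rightarrow> ((nat \<Rightarrow> bit) list \<times> nat) pmf" where
  "ensemble N K = pair_pmf (draw_without_replacement (2 ^ K) (F2 N)) (pmf_of_set {..<2 ^ K})"

definition sent :: "(nat \<Rightarrow> bit) list \<times> nat \<Rightarrow> (nat \<Rightarrow> bit)" where
  "sent = (\<lambda>(C, m). C ! m)"

text \<open>Joint law of ((codebook, message index), channel output).\<close>

definition joint ::
    "(bit \<Rightarrow> real \<Rightarrow> real) \<Rightarrow> nat \<Rightarrow> nat \<Rightarrow> (((nat \<Rightarrow> bit) list \<times> nat) \<times> (nat \<Rightarrow> real)) measure" where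
  "joint q N K =
    measure_pmf (ensemble N K) \<bind> (\<lambda>s.
      distr (channel q N (sent s)) (count_space UNIV \<Otimes>\<^sub>M PiM {1..N} (\<lambda>_. borel)) (Pair s))"

text \<open>Posterior of the transmitted codeword, averaged over the ensemble, by Bayes' rule for
  densities. It is \<open>0 / 0 = 0\<close> only where the output density vanishes.\<close>

definition posterior ::
    "(bit \<Rightarrow> real \<Rightarrow> real) \<Rightarrow> nat \<Rightarrow> nat \<Rightarrow> (nat \<Rightarrow> bit) \<Rightarrow> (nat \<Rightarrow> real) \<Rightarrow> real" where
  "posterior q N K w y =
    pmf (map_pmf sent (ensemble N K)) w * likelihood q N w y /
    (\<Sum>v\<in>F2 N. pmf (map_pmf sent (ensemble N K)) v * likelihood q N v y)"

definition test_word ::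
    "(bit \<Rightarrow> real \<Rightarrow> real) \<Rightarrow> nat \<Rightarrow> (nat \<Rightarrow> nat \<Rightarrow> bit) \<Rightarrow> ((nat \<Rightarrow> real) \<Rightarrow> nat \<Rightarrow> nat) \<Rightarrow>
     nat \<Rightarrow> (nat \<Rightarrow> real) \<Rightarrow> (nat \<Rightarrow> bit)" where
  "test_word q N e \<pi> t y = xor_vec N (hard_decision q N y) (permute_vec N (\<pi> y) (e t))"

definition num_tests ::
    "(bit \<Rightarrow> real \<Rightarrow> real) \<Rightarrow> nat \<Rightarrow> nat \<Rightarrow> (nat \<Rightarrow> nat \<Rightarrow> bit) \<Rightarrow> ((nat \<Rightarrow> real) \<Rightarrow> nat \<Rightarrow> nat) \<Rightarrow>
     (nat \<Rightarrow> bit) set \<Rightarrow> (nat \<Rightarrow> real) \<Rightarrow> nat" where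
  "num_tests q N T e \<pi> C y =
    (if \<exists>t\<in>{1..T}. test_word q N e \<pi> t y \<in> C
     then LEAST t. t \<in> {1..T} \<and> test_word q N e \<pi> t y \<in> C
     else T)"

definition P_stop ::
    "(bit \<Rightarrow> real \<Rightarrow> real) \<Rightarrow> nat \<Rightarrow> nat \<Rightarrow> nat \<Rightarrow> (nat \<Rightarrow> nat \<Rightarrow> bit) \<Rightarrow>
     ((nat \<Rightarrow> real) \<Rightarrow> nat \<Rightarrow> nat) \<Rightarrow> nat \<Rightarrow> real" where
  "P_stop q N K T e \<pi> t =
    \<P>(((C, m), y) in joint q N K. num_tests q N T e \<pi> (set C) y = t)"

definition p_hit ::
    "(bit \<Rightarrow> real \<Rightarrow> real) \<Rightarrow> nat \<Rightarrow> nat \<Rightarrow> (nat \<Rightarrow> nat \<Rightarrow> bit) \<Rightarrow> ((nat \<Rightarrow> real) \<Rightarrow> nat \<Rightarrow> nat) \<Rightarrow>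
     nat \<Rightarrow> real" where
  "p_hit q N K e \<pi> t =
    (\<integral>(s, y). posterior q N K (test_word q N e \<pi> t y) y \<partial>joint q N K)"

definition pre_target_hit :: "nat \<Rightarrow> nat \<Rightarrow> nat \<Rightarrow> real" where
  "pre_target_hit N K t =
    1 - (\<Prod>i\<in>{1..<t}. ((2::real) ^ N - 2 ^ K + 1 - real i) / (2 ^ N - real i))"

end

theory Submission
  imports Defs
begin

text \<open>
  Write \<open>M = 2 ^ N\<close>, \<open>n = 2 ^ K\<close>, and let \<open>u\<^sub>1, \<dots>, u\<^sub>T\<close> be the words tested for a given output \<open>y\<close>;
  they are distinct. Given the transmitted word \<open>w\<close>, the other codewords form a uniformly random
  \<open>(n - 1)\<close>-subset of the remaining \<open>M - 1\<close> words, so all of \<open>u\<^sub>1, \<dots>, u\<^bsub>t-1\<^esub>\<close> miss the code with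
  probability \<open>(M - t choose n - 1) / (M - 1 choose n - 1) = 1 - f t\<close> if \<open>w\<close> is none of them, and
  with probability \<open>0\<close> otherwise. Averaging over \<open>w\<close> and \<open>y\<close>, at least \<open>t\<close> tests are made with
  probability \<open>(1 - (\<Sum>i<t. p i)) * (1 - f t)\<close>, and the stopping probabilities are the successive
  differences of this sequence.
\<close>

section \<open>Lists without repetition and sampling without replacement\<close>

definition distinct_lists :: "nat \<Rightarrow> 'a set \<Rightarrow> 'a list set" where
  "distinct_lists n A = {xs. length xs = n \<and> distinct xs \<and> set xs \<subseteq> A}"

lemma distinct_lists_0: "distinct_lists 0 A = {[]}"
  by (auto simp: distinct_lists_def)

lemma distinct_lists_Suc:
  "distinct_lists (Suc n) A = (\<Union>x\<in>A. (#) x ` distinct_lists n (A - {x}))"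
  by (fastforce simp: distinct_lists_def length_Suc_conv image_iff)

lemma distinct_lists_disjoint: "disjoint_family_on (\<lambda>x. (#) x ` distinct_lists n (B x)) A"
  by (auto simp: disjoint_family_on_def)

lemma finite_distinct_lists: "finite A \<Longrightarrow> finite (distinct_lists n A)"
  by (rule finite_subset[OF _ finite_lists_length_eq[of A n]]) (auto simp: distinct_lists_def)

text \<open>The falling factorial is written as a factorial times a binomial coefficient, so that
  the factorials cancel in later quotients of counts. It stays correct when \<open>n\<close> exceeds
  \<open>card A\<close>, both sides then being zero.\<close>

lemma card_distinct_lists:
  "finite A \<Longrightarrow> card (distinct_lists n A) = fact n * (card A choose n)"
proof (induction n arbitrary: A)
  case 0
  then show ?case by (simp add: distinct_lists_0)
next
  case (Suc n)
  have "card (distinct_lists (Suc n) A) = (\<Sum>x\<in>A. card ((#) x ` distinct_lists n (A - {x})))"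
    unfolding distinct_lists_Suc
    by (rule card_UN_disjoint'[OF distinct_lists_disjoint])
      (use Suc.prems in \<open>auto intro: finite_distinct_lists\<close>)
  also have "\<dots> = (\<Sum>x\<in>A. fact n * ((card A - 1) choose n))"
    using Suc by (intro sum.cong) (auto simp: card_image)
  \<comment> \<open>The lower index is kept as \<open>Suc n - 1\<close> to match the absorption
    identity \<open>times_binomial_minus1_eq\<close>.\<close>
  also have "\<dots> = fact n * (card A * ((card A - 1) choose (Suc n - 1)))"
    by simp
  also have "\<dots> = fact (Suc n) * (card A choose Suc n)"
    by (subst times_binomial_minus1_eq[symmetric]) (auto simp: algebra_simps)
  finally show ?case .
qed

lemma distinct_lists_nonempty:
  assumes "finite A" "n \<le> card A"
  shows "distinct_lists n A \<noteq> {}"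
proof -
  have "card (distinct_lists n A) > 0"
    using assms by (simp add: card_distinct_lists zero_less_binomial)
  then show ?thesis
    by fastforce
qed

text \<open>Grouped by first entry, the target lists fall into disjoint blocks of equal size. A
  uniform choice of block followed by a uniform choice inside it is therefore uniform on the
  union.\<close>

lemma draw_without_replacement_uniform:
  assumes "finite A" "n \<le> card A"
  shows "draw_without_replacement n A = pmf_of_set (distinct_lists n A)"
  using assms
proof (induction n arbitrary: A)
  case 0
  then show ?case by (simp add: distinct_lists_0 pmf_of_set_singleton)
next
  case (Suc n)
  have "draw_without_replacement (Suc n) A =
      bind_pmf (pmf_of_set A) (\<lambda>x. pmf_of_set ((#) x ` distinct_lists n (A - {x})))"
    unfolding draw_without_replacement.simps
  proof (rule bind_pmf_cong[OF refl])
    fix x assume "x \<in> set_pmf (pmf_of_set A)"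
    then have "x \<in> A"
      using Suc.prems by (subst (asm) set_pmf_of_set) auto
    have fin: "finite (A - {x})" and le: "n \<le> card (A - {x})"
      using Suc.prems \<open>x \<in> A\<close> by auto
    have "map_pmf ((#) x) (draw_without_replacement n (A - {x})) =
        map_pmf ((#) x) (pmf_of_set (distinct_lists n (A - {x})))"
      by (simp only: Suc.IH[OF fin le])
    also have "\<dots> = pmf_of_set ((#) x ` distinct_lists n (A - {x}))"
      by (rule map_pmf_of_set_inj[OF _ distinct_lists_nonempty[OF fin le]
            finite_distinct_lists[OF fin]]) simp
    finally show "map_pmf ((#) x) (draw_without_replacement n (A - {x})) =
        pmf_of_set ((#) x ` distinct_lists n (A - {x}))" .
  qed
  also have "\<dots> = pmf_of_set (\<Union>x\<in>A. (#) x ` distinct_lists n (A - {x}))"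
  proof (rule pmf_of_set_UN[symmetric, OF _ _ _ _ distinct_lists_disjoint])
    show "finite (\<Union>x\<in>A. (#) x ` distinct_lists n (A - {x}))"
      using Suc.prems by (auto intro: finite_distinct_lists)
    show "A \<noteq> {}" using Suc.prems by auto
    fix x assume "x \<in> A"
    then show "(#) x ` distinct_lists n (A - {x}) \<noteq> {}"
      using Suc.prems distinct_lists_nonempty[of "A - {x}" n] by simp
    show "card ((#) x ` distinct_lists n (A - {x})) = fact n * ((card A - 1) choose n)"
      using \<open>x \<in> A\<close> Suc.prems by (simp add: card_image card_distinct_lists)
  qed
  finally show ?case
    by (simp only: distinct_lists_Suc)
qed

lemma pair_pmf_of_set:
  assumes "finite A" "A \<noteq> {}" "finite B" "B \<noteq> {}"
  shows "pair_pmf (pmf_of_set A) (pmf_of_set B) = pmf_of_set (A \<times> B)"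
proof (rule pmf_eqI)
  fix x :: "'a \<times> 'b"
  show "pmf (pair_pmf (pmf_of_set A) (pmf_of_set B)) x = pmf (pmf_of_set (A \<times> B)) x"
    using assms by (cases x) (simp add: pmf_pair indicator_def card_cartesian_product)
qed

section \<open>The random code ensemble as a uniform distribution\<close>

lemma UNIV_bit: "(UNIV :: bit set) = {0, 1}"
  by (metis (full_types) UNIV_eq_I bit_not_one_iff insert_iff)

lemma finite_F2: "finite (F2 N)"
  unfolding F2_def by (intro finite_PiE) (auto simp: UNIV_bit)

lemma card_F2: "card (F2 N) = 2 ^ N"
  unfolding F2_def UNIV_bit by (simp add: card_PiE numeral_2_eq_2)

lemma distinct_lists_F2_nonempty: "K \<le> N \<Longrightarrow> distinct_lists (2 ^ K) (F2 N) \<noteq> {}"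
  by (rule distinct_lists_nonempty[OF finite_F2]) (simp add: card_F2)

text \<open>Turns probabilities over the ensemble into quotients of cardinalities.\<close>

lemma ensemble_uniform:
  assumes "K \<le> N"
  shows "ensemble N K = pmf_of_set (distinct_lists (2 ^ K) (F2 N) \<times> {..<2 ^ K})"
proof -
  have "2 ^ K \<le> card (F2 N)" using assms by (simp add: card_F2)
  then have "ensemble N K =
      pair_pmf (pmf_of_set (distinct_lists (2 ^ K) (F2 N))) (pmf_of_set {..<2 ^ K})"
    unfolding ensemble_def by (simp only: draw_without_replacement_uniform[OF finite_F2])
  also have "\<dots> = pmf_of_set (distinct_lists (2 ^ K) (F2 N) \<times> {..<2 ^ K})"
    by (rule pair_pmf_of_set[OF finite_distinct_lists[OF finite_F2]
          distinct_lists_F2_nonempty[OF assms]]) (simp_all add: lessThan_empty_iff)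
  finally show ?thesis .
qed

lemma set_pmf_ensemble:
  assumes "K \<le> N"
  shows "set_pmf (ensemble N K) = distinct_lists (2 ^ K) (F2 N) \<times> {..<2 ^ K}"
  unfolding ensemble_uniform[OF assms]
proof (rule set_pmf_of_set)
  have "{..<(2::nat) ^ K} \<noteq> {}"
    by (simp add: lessThan_empty_iff)
  then show "distinct_lists (2 ^ K) (F2 N) \<times> {..<(2::nat) ^ K} \<noteq> {}"
    using distinct_lists_F2_nonempty[OF assms] by blast
qed (auto intro: finite_distinct_lists finite_F2)

lemma finite_set_pmf_ensemble: "K \<le> N \<Longrightarrow> finite (set_pmf (ensemble N K))"
  by (simp add: set_pmf_ensemble finite_distinct_lists finite_F2)

lemma sent_in_F2:
  assumes "K \<le> N" "s \<in> set_pmf (ensemble N K)"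
  shows "sent s \<in> F2 N"
  using assms by (force simp: set_pmf_ensemble sent_def distinct_lists_def)

section \<open>Probability that a random codebook misses a given set of words\<close>

lemma card_distinct_lists_with_position:
  assumes "finite B" "w \<in> B" "0 < n"
  shows "card {(C, m). C \<in> distinct_lists n B \<and> m < n \<and> C ! m = w} =
    fact n * ((card B - 1) choose (n - 1))"
proof -
  \<comment> \<open>A list without repetitions has at most one position holding \<open>w\<close>.\<close>
  have "bij_betw fst {(C, m). C \<in> distinct_lists n B \<and> m < n \<and> C ! m = w}
      (distinct_lists n B - distinct_lists n (B - {w}))"
    unfolding bij_betw_def
  proof (intro conjI set_eqI iffI)
    fix C assume "C \<in> distinct_lists n B - distinct_lists n (B - {w})"
    then have C: "C \<in> distinct_lists n B" "w \<in> set C"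
      by (auto simp: distinct_lists_def)
    then obtain m where "m < n" "C ! m = w"
      by (auto simp: distinct_lists_def in_set_conv_nth)
    with C show "C \<in> fst ` {(C, m). C \<in> distinct_lists n B \<and> m < n \<and> C ! m = w}"
      by force
  qed (auto simp: distinct_lists_def inj_on_def nth_eq_iff_index_eq subset_Diff_insert)
  then have "card {(C, m). C \<in> distinct_lists n B \<and> m < n \<and> C ! m = w} =
      card (distinct_lists n B - distinct_lists n (B - {w}))"
    by (rule bij_betw_same_card)
  also have "\<dots> = card (distinct_lists n B) - card (distinct_lists n (B - {w}))"
    using assms by (intro card_Diff_subset finite_distinct_lists) (auto simp: distinct_lists_def)
  also have "\<dots> = fact n * (card B choose n) - fact n * ((card B - 1) choose n)"
    using assms by (simp add: card_distinct_lists)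
  \<comment> \<open>Pascal's rule, available once both indices are exposed as successors.\<close>
  also have "\<dots> = fact n * ((card B - 1) choose (n - 1))"
  proof -
    have "card B \<noteq> 0" using assms by auto
    then obtain b where "card B = Suc b" using not0_implies_Suc by blast
    moreover obtain k where "n = Suc k" using assms gr0_implies_Suc by blast
    ultimately show ?thesis by (simp add: add_mult_distrib2)
  qed
  finally show ?thesis .
qed

text \<open>The favourable outcomes are the repetition-free lists over \<open>F2 N - A\<close> with
  \<open>w\<close> at the message position, counted by the preceding lemma. The quotient factors
  into \<open>1 / 2 ^ N\<close> for sending \<open>w\<close> and the conditional probability that
  the remaining codewords miss \<open>A\<close>.\<close>

lemma prob_sent_avoiding:
  assumes "K \<le> N" "A \<subseteq> F2 N" "w \<in> F2 N - A"
  shows "measure_pmf.prob (ensemble N K) {(C, m). sent (C, m) = w \<and> set C \<inter> A = {}} =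
    real (2 ^ N - 1 - card A choose (2 ^ K - 1)) / (2 ^ N * real (2 ^ N - 1 choose (2 ^ K - 1)))"
proof -
  define n M :: nat where "n = 2 ^ K" and "M = 2 ^ N"
  have n: "0 < n" and M: "0 < M" and nM: "n \<le> M"
    using assms by (auto simp: n_def M_def)
  let ?L = "distinct_lists n (F2 N)"
  have finA: "finite A" using assms finite_F2 finite_subset by blast
  have cardB: "card (F2 N - A) = M - card A"
    using assms finA by (simp add: card_Diff_subset card_F2 M_def)
  have "?L \<times> {..<n} \<inter> {(C, m). sent (C, m) = w \<and> set C \<inter> A = {}} =
      {(C, m). C \<in> distinct_lists n (F2 N - A) \<and> m < n \<and> C ! m = w}"
    by (auto simp: sent_def distinct_lists_def)
  then have "measure_pmf.prob (ensemble N K) {(C, m). sent (C, m) = w \<and> set C \<inter> A = {}} =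
      real (card {(C, m). C \<in> distinct_lists n (F2 N - A) \<and> m < n \<and> C ! m = w}) /
      real (card (?L \<times> {..<n}))"
    unfolding ensemble_uniform[OF assms(1)] n_def[symmetric]
    using nM n distinct_lists_nonempty[OF finite_F2, of n N]
    by (subst measure_pmf_of_set)
      (auto intro!: finite_distinct_lists finite_F2 simp: card_F2 M_def lessThan_empty_iff)
  also have "\<dots> = (fact n * real (M - card A - 1 choose (n - 1))) / (real n * (fact n * real (M choose n)))"
    using n assms finite_F2[of N]
    by (simp add: card_distinct_lists_with_position cardB card_distinct_lists card_F2 M_def
        card_cartesian_product mult.commute)
  also have "\<dots> = real (M - card A - 1 choose (n - 1)) / (real n * real (M choose n))"
    by simp
  \<comment> \<open>Absorption trades the number of messages for the number of words, which isolates
    the factor \<open>2 ^ N\<close>.\<close>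
  also have "real n * real (M choose n) = real M * real (M - 1 choose (n - 1))"
    using times_binomial_minus1_eq[OF n, of M] by (metis of_nat_mult)
  finally show ?thesis
    by (simp add: n_def M_def)
qed

text \<open>Raising \<open>t\<close> by one multiplies the quotient by \<open>(m - k) / m\<close>
  with \<open>m = 2 ^ N - t\<close> and \<open>k = 2 ^ K - 1\<close>, which is precisely the next
  factor of the product in \<open>pre_target_hit\<close>.\<close>

lemma binomial_ratio_pre_target_hit:
  assumes "K \<le> N" "1 \<le> t" "t \<le> 2 ^ N"
  shows "real (2 ^ N - t choose (2 ^ K - 1)) / real (2 ^ N - 1 choose (2 ^ K - 1)) =
    1 - pre_target_hit N K t"
  using assms(2,3)
proof (induction t rule: dec_induct)
  case base
  have "(2::nat) ^ K - 1 \<le> 2 ^ N - 1"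
    using assms(1) by (intro diff_le_mono) simp
  then have "real (2 ^ N - 1 choose (2 ^ K - 1)) \<noteq> 0"
    by simp
  then show ?case
    by (simp add: pre_target_hit_def)
next
  case (step t)
  define m k :: nat where "m = 2 ^ N - t" and "k = 2 ^ K - 1"
  have m: "m > 0" and mN: "real m = 2 ^ N - real t" and kK: "real k = 2 ^ K - 1"
    using step.prems by (auto simp: m_def k_def of_nat_diff)
  have "m * (m - 1 choose k) = (m - k) * (m choose k)"
    using binomial_absorb_comp[of m k] by simp
  \<comment> \<open>When \<open>k > m\<close> the natural subtraction truncates, but then
    \<open>m choose k\<close> vanishes and both sides are zero.\<close>
  moreover have "real ((m - k) * (m choose k)) = (real m - real k) * real (m choose k)"
    by (cases "k \<le> m") (auto simp: of_nat_diff)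
  ultimately have "real m * real (m - 1 choose k) = (real m - real k) * real (m choose k)"
    by (metis of_nat_mult)
  then have *: "real (m - 1 choose k) = real (m choose k) * ((real m - real k) / real m)"
    using m by (simp add: field_simps)
  have "1 - pre_target_hit N K (Suc t) = (1 - pre_target_hit N K t) * ((real m - real k) / real m)"
    using step.hyps
    by (simp add: pre_target_hit_def prod.atLeastLessThan_Suc mN kK algebra_simps)
  also have "1 - pre_target_hit N K t = real (m choose k) / real (2 ^ N - 1 choose k)"
    using step.IH step.prems by (simp add: m_def k_def)
  also have "\<dots> * ((real m - real k) / real m) = real (m - 1 choose k) / real (2 ^ N - 1 choose k)"
    unfolding * by simp
  finally show ?case
    by (simp add: m_def k_def)
qed

text \<open>The likelihood depends on an outcome only through the transmitted word, so outcomes are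
  grouped by that word. It serves both for averaging the posterior (with \<open>P\<close> trivial)
  and for the avoidance event.\<close>

lemma sum_pmf_ensemble_sent:
  assumes "K \<le> N"
  shows "(\<Sum>s\<in>set_pmf (ensemble N K). pmf (ensemble N K) s * (h (sent s) * of_bool (P s))) =
    (\<Sum>w\<in>F2 N. h w * measure_pmf.prob (ensemble N K) {s. sent s = w \<and> P s})"
proof -
  let ?S = "set_pmf (ensemble N K)"
  have "(\<Sum>s\<in>?S. pmf (ensemble N K) s * (h (sent s) * of_bool (P s))) =
      (\<Sum>w\<in>F2 N. \<Sum>s | s \<in> ?S \<and> sent s = w. pmf (ensemble N K) s * (h (sent s) * of_bool (P s)))"
    using assms
    by (intro sum.group[symmetric] finite_set_pmf_ensemble finite_F2) (auto intro: sent_in_F2)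
  also have "\<dots> = (\<Sum>w\<in>F2 N. h w * measure_pmf.prob (ensemble N K) {s. sent s = w \<and> P s})"
  proof (rule sum.cong[OF refl])
    fix w
    have "measure_pmf.prob (ensemble N K) {s. sent s = w \<and> P s} =
        measure_pmf.prob (ensemble N K) ({s. sent s = w \<and> P s} \<inter> ?S)"
      by (simp add: measure_Int_set_pmf)
    also have "\<dots> = (\<Sum>s\<in>{s. sent s = w \<and> P s} \<inter> ?S. pmf (ensemble N K) s)"
      using assms by (intro measure_measure_pmf_finite) (simp add: finite_set_pmf_ensemble)
    also have "\<dots> = (\<Sum>s | s \<in> ?S \<and> sent s = w. pmf (ensemble N K) s * of_bool (P s))"
      using finite_set_pmf_ensemble[OF assms]
      by (intro sum.mono_neutral_cong_left) auto
    finally show "(\<Sum>s | s \<in> ?S \<and> sent s = w. pmf (ensemble N K) s * (h (sent s) * of_bool (P s))) =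
        h w * measure_pmf.prob (ensemble N K) {s. sent s = w \<and> P s}"
      by (simp add: sum_distrib_left mult_ac)
  qed
  finally show ?thesis .
qed

lemma sent_in_codebook:
  assumes "K \<le> N" "s \<in> set_pmf (ensemble N K)"
  shows "sent s \<in> set (fst s)"
  using assms by (auto simp: set_pmf_ensemble sent_def distinct_lists_def)

text \<open>The case \<open>A = {}\<close> of \<open>prob_sent_avoiding\<close>, where the two
  binomial coefficients cancel.\<close>

lemma pmf_sent:
  assumes "K \<le> N" "w \<in> F2 N"
  shows "pmf (map_pmf sent (ensemble N K)) w = 1 / 2 ^ N"
proof -
  have "{(C, m). sent (C, m) = w \<and> set C \<inter> {} = {}} = sent -` {w}"
    by auto
  moreover have "(2::nat) ^ K - 1 \<le> 2 ^ N - 1"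
    using assms(1) by (intro diff_le_mono) simp
  then have "real (2 ^ N - 1 choose (2 ^ K - 1)) \<noteq> 0"
    by simp
  ultimately show ?thesis
    using prob_sent_avoiding[of K N "{}" w] assms by (simp add: pmf_map)
qed

\<comment> \<open>Otherwise \<open>{1..N}\<close> is rewritten to \<open>{Suc 0..N}\<close>, and the rules on product measures no longer match.\<close>
declare One_nat_def [simp del]

section \<open>The memoryless channel and integration against the joint law\<close>

locale binary_channel =
  fixes q :: "bit \<Rightarrow> real \<Rightarrow> real"
  assumes q_measurable [measurable]: "\<And>b. q b \<in> borel_measurable borel"
    and q_nonneg: "\<And>b x. 0 \<le> q b x"
    and q_integral: "\<And>b. (\<integral>\<^sup>+ x. ennreal (q b x) \<partial>lborel) = 1"
begin

abbreviation output_space :: "nat \<Rightarrow> (nat \<Rightarrow> real) measure" where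
  "output_space N \<equiv> PiM {1..N} (\<lambda>_. lborel)"

text \<open>Integrals use the Lebesgue product, while \<open>joint\<close> and the permutation law
  use the Borel product; this lets measurability pass between the two.\<close>

lemma sets_output_space [measurable_cong]: "sets (output_space N) = sets (PiM {1..N} (\<lambda>_. borel))"
  by (intro sets_PiM_cong) auto

lemma likelihood_measurable [measurable]:
  "likelihood q N w \<in> borel_measurable (PiM {1..N} (\<lambda>_. borel))"
  unfolding likelihood_def by measurable

lemma likelihood_nonneg: "0 \<le> likelihood q N w y"
  unfolding likelihood_def by (intro prod_nonneg) (auto intro: q_nonneg)

lemma nn_integral_likelihood: "(\<integral>\<^sup>+ y. ennreal (likelihood q N w y) \<partial>output_space N) = 1"
proof -
  interpret product_sigma_finite "\<lambda>_::nat. lborel :: real measure"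
    by standard
  have "(\<integral>\<^sup>+ y. ennreal (likelihood q N w y) \<partial>output_space N) =
      (\<integral>\<^sup>+ y. (\<Prod>i\<in>{1..N}. ennreal (q (w i) (y i))) \<partial>output_space N)"
    unfolding likelihood_def by (intro nn_integral_cong prod_ennreal[symmetric] q_nonneg)
  also have "\<dots> = (\<Prod>i\<in>{1..N}. \<integral>\<^sup>+ x. ennreal (q (w i) x) \<partial>lborel)"
    by (rule product_nn_integral_prod) auto
  finally show ?thesis
    by (simp add: q_integral)
qed

lemma likelihood_integrable: "integrable (output_space N) (likelihood q N w)"
  by (rule integrableI_nonneg) (auto simp: nn_integral_likelihood likelihood_nonneg)

lemma integral_likelihood: "(\<integral>y. likelihood q N w y \<partial>output_space N) = 1"
  by (subst integral_eq_nn_integral) (auto simp: nn_integral_likelihood likelihood_nonneg)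

lemma prob_space_channel: "prob_space (channel q N w)"
proof (rule prob_spaceI)
  show "emeasure (channel q N w) (space (channel q N w)) = 1"
    unfolding channel_def
    by (subst emeasure_density) (auto simp: nn_integral_likelihood cong: nn_integral_cong_simp)
qed

lemma Pair_measurable_channel:
  "Pair s \<in> channel q N w \<rightarrow>\<^sub>M count_space UNIV \<Otimes>\<^sub>M PiM {1..N} (\<lambda>_. borel)"
  unfolding channel_def by measurable

lemma joint_kernel:
  "(\<lambda>s. distr (channel q N (sent s)) (count_space UNIV \<Otimes>\<^sub>M PiM {1..N} (\<lambda>_. borel)) (Pair s))
    \<in> measure_pmf p \<rightarrow>\<^sub>M subprob_algebra (count_space UNIV \<Otimes>\<^sub>M PiM {1..N} (\<lambda>_. borel))"
  by (auto simp: space_subprob_algebra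
      intro!: prob_space_imp_subprob_space prob_space.prob_space_distr prob_space_channel
        Pair_measurable_channel)

lemma sets_joint [measurable_cong]:
  "sets (joint q N K) = sets (count_space UNIV \<Otimes>\<^sub>M PiM {1..N} (\<lambda>_. borel))"
  unfolding joint_def by (rule sets_bind) auto

text \<open>The ensemble has finite support, so its integral is a finite sum that can be moved
  inside the integral over outputs. Later arguments can then work at a fixed
  \<open>y\<close>.\<close>

lemma nn_integral_joint:
  assumes "K \<le> N"
    and g[measurable]: "g \<in> borel_measurable (count_space UNIV \<Otimes>\<^sub>M PiM {1..N} (\<lambda>_. borel))"
  shows "(\<integral>\<^sup>+ x. g x \<partial>joint q N K) =
    (\<integral>\<^sup>+ y. (\<Sum>s\<in>set_pmf (ensemble N K).
        ennreal (pmf (ensemble N K) s * likelihood q N (sent s) y) * g (s, y)) \<partial>output_space N)"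
proof -
  have [measurable]: "(\<lambda>y. g (s, y)) \<in> borel_measurable (PiM {1..N} (\<lambda>_. borel))" for s
    by measurable
  have "(\<integral>\<^sup>+ x. g x \<partial>joint q N K) =
      (\<integral>\<^sup>+ s. \<integral>\<^sup>+ x. g x \<partial>distr (channel q N (sent s))
        (count_space UNIV \<Otimes>\<^sub>M PiM {1..N} (\<lambda>_. borel)) (Pair s) \<partial>ensemble N K)"
    unfolding joint_def by (rule nn_integral_bind[OF g joint_kernel])
  also have "\<dots> = (\<integral>\<^sup>+ s. \<integral>\<^sup>+ y. ennreal (likelihood q N (sent s) y) * g (s, y)
      \<partial>output_space N \<partial>ensemble N K)"
  proof (rule nn_integral_cong)
    fix s
    have "(\<integral>\<^sup>+ x. g x \<partial>distr (channel q N (sent s))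
        (count_space UNIV \<Otimes>\<^sub>M PiM {1..N} (\<lambda>_. borel)) (Pair s)) =
        (\<integral>\<^sup>+ y. g (s, y) \<partial>channel q N (sent s))"
      by (rule nn_integral_distr[OF Pair_measurable_channel]) (simp add: g)
    also have "\<dots> = (\<integral>\<^sup>+ y. ennreal (likelihood q N (sent s) y) * g (s, y) \<partial>output_space N)"
      unfolding channel_def by (rule nn_integral_density) measurable
    finally show "(\<integral>\<^sup>+ x. g x \<partial>distr (channel q N (sent s))
        (count_space UNIV \<Otimes>\<^sub>M PiM {1..N} (\<lambda>_. borel)) (Pair s)) = \<dots>" .
  qed
  also have "\<dots> = (\<Sum>s\<in>set_pmf (ensemble N K).
      (\<integral>\<^sup>+ y. ennreal (likelihood q N (sent s) y) * g (s, y) \<partial>output_space N) *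
        ennreal (pmf (ensemble N K) s))"
    using assms(1) by (intro nn_integral_measure_pmf_finite finite_set_pmf_ensemble) auto
  also have "\<dots> = (\<Sum>s\<in>set_pmf (ensemble N K). \<integral>\<^sup>+ y.
      ennreal (pmf (ensemble N K) s * likelihood q N (sent s) y) * g (s, y) \<partial>output_space N)"
    by (intro sum.cong refl, subst nn_integral_multc[symmetric])
      (auto simp: ennreal_mult likelihood_nonneg mult_ac)
  also have "\<dots> = (\<integral>\<^sup>+ y. (\<Sum>s\<in>set_pmf (ensemble N K).
        ennreal (pmf (ensemble N K) s * likelihood q N (sent s) y) * g (s, y)) \<partial>output_space N)"
    by (rule nn_integral_sum[symmetric]) measurable
  finally show ?thesis .
qed

text \<open>Nonnegativity makes both sides \<open>enn2real\<close> of the same extended integral, so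
  no integrability has to be checked.\<close>

lemma integral_joint:
  fixes g :: "((nat \<Rightarrow> bit) list \<times> nat) \<times> (nat \<Rightarrow> real) \<Rightarrow> real"
  assumes "K \<le> N"
    and g[measurable]: "g \<in> borel_measurable (count_space UNIV \<Otimes>\<^sub>M PiM {1..N} (\<lambda>_. borel))"
    and nonneg: "\<And>x. 0 \<le> g x"
  shows "(\<integral>x. g x \<partial>joint q N K) =
    (\<integral>y. (\<Sum>s\<in>set_pmf (ensemble N K).
        pmf (ensemble N K) s * (likelihood q N (sent s) y * g (s, y))) \<partial>output_space N)"
proof -
  have [measurable]: "(\<lambda>y. g (s, y)) \<in> borel_measurable (PiM {1..N} (\<lambda>_. borel))" for s
    by measurable
  have "(\<integral>x. g x \<partial>joint q N K) = enn2real (\<integral>\<^sup>+ x. ennreal (g x) \<partial>joint q N K)"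
    using nonneg by (intro integral_eq_nn_integral) auto
  also have "(\<integral>\<^sup>+ x. ennreal (g x) \<partial>joint q N K) =
      (\<integral>\<^sup>+ y. (\<Sum>s\<in>set_pmf (ensemble N K).
        ennreal (pmf (ensemble N K) s * likelihood q N (sent s) y) * ennreal (g (s, y)))
        \<partial>output_space N)"
    by (rule nn_integral_joint[OF assms(1)]) measurable
  also have "\<dots> = (\<integral>\<^sup>+ y. ennreal (\<Sum>s\<in>set_pmf (ensemble N K).
        pmf (ensemble N K) s * (likelihood q N (sent s) y * g (s, y))) \<partial>output_space N)"
    by (intro nn_integral_cong)
      (auto simp: likelihood_nonneg nonneg simp flip: ennreal_mult mult.assoc intro!: sum_ennreal)
  also have "enn2real \<dots> = (\<integral>y. (\<Sum>s\<in>set_pmf (ensemble N K).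
        pmf (ensemble N K) s * (likelihood q N (sent s) y * g (s, y))) \<partial>output_space N)"
    by (intro integral_eq_nn_integral[symmetric] AE_I2)
      (auto intro!: sum_nonneg mult_nonneg_nonneg simp: likelihood_nonneg nonneg)
  finally show ?thesis .
qed

lemma prob_space_joint: "prob_space (joint q N K)"
  unfolding joint_def
  by (rule prob_space.prob_space_bind[OF _ _ joint_kernel])
    (auto intro!: AE_I2 measure_pmf.prob_space_axioms prob_space.prob_space_distr
      prob_space_channel Pair_measurable_channel)

text \<open>The range is finite, so measurable fibres suffice, and each fibre is a finite
  conjunction of conditions on single coordinates.\<close>

lemma hard_decision_measurable [measurable]:
  "hard_decision q N \<in> PiM {1..N} (\<lambda>_. borel) \<rightarrow>\<^sub>M count_space (F2 N)"
proof -
  have [measurable]: "llr q \<in> borel_measurable borel"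
    unfolding llr_def by measurable
  have "hard_decision q N -` {w} \<inter> space (PiM {1..N} (\<lambda>_. borel)) \<in> sets (PiM {1..N} (\<lambda>_. borel))"
    if "w \<in> F2 N" for w
  proof -
    have "hard_decision q N -` {w} \<inter> space (PiM {1..N} (\<lambda>_. borel)) =
        {y \<in> space (PiM {1..N} (\<lambda>_. borel)). \<forall>i\<in>{1..N}. (llr q (y i) < 0) = (w i = 1)}"
      using that
      by (auto simp: hard_decision_def F2_def fun_eq_iff PiE_iff extensional_def split: if_splits)
    also have "\<dots> \<in> sets (PiM {1..N} (\<lambda>_. borel))"
      by measurable
    finally show ?thesis .
  qed
  then show ?thesis
    by (subst measurable_count_space_eq2[OF finite_F2]) (auto simp: hard_decision_def F2_def)
qed

end

section \<open>The tested words and their hit probabilities\<close>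

locale orb_grand = binary_channel +
  fixes N K T :: nat
    and e :: "nat \<Rightarrow> nat \<Rightarrow> bit"
    and \<pi> :: "(nat \<Rightarrow> real) \<Rightarrow> nat \<Rightarrow> nat"
  assumes K_le: "K \<le> N" and T_pos: "1 \<le> T" and T_le: "T \<le> 2 ^ N"
    and e_F2: "\<And>t. t \<in> {1..T} \<Longrightarrow> e t \<in> F2 N"
    and e_inj: "inj_on e {1..T}"
    and pi_measurable: "\<pi> \<in> PiM {1..N} (\<lambda>_. borel) \<rightarrow>\<^sub>M count_space {p. p permutes {1..N}}"
begin

abbreviation guess :: "nat \<Rightarrow> (nat \<Rightarrow> real) \<Rightarrow> (nat \<Rightarrow> bit)" where
  "guess t y \<equiv> test_word q N e \<pi> t y"

text \<open>For a fixed permutation the guess is a function of the hard decision. These maps are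
  glued along \<open>\<pi>\<close>, which takes only finitely many values.\<close>

lemma guess_measurable [measurable]: "guess t \<in> PiM {1..N} (\<lambda>_. borel) \<rightarrow>\<^sub>M count_space (F2 N)"
proof -
  have "(\<lambda>v. xor_vec N v (permute_vec N p (e t))) \<in> count_space (F2 N) \<rightarrow>\<^sub>M count_space (F2 N)" for p
    by (auto simp: xor_vec_def F2_def)
  then have "(\<lambda>y. xor_vec N (hard_decision q N y) (permute_vec N p (e t)))
      \<in> PiM {1..N} (\<lambda>_. borel) \<rightarrow>\<^sub>M count_space (F2 N)" for p
    by (rule measurable_compose[OF hard_decision_measurable])
  then have "(\<lambda>y. xor_vec N (hard_decision q N y) (permute_vec N (\<pi> y) (e t)))
      \<in> PiM {1..N} (\<lambda>_. borel) \<rightarrow>\<^sub>M count_space (F2 N)"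
    by (rule measurable_compose_countable'[OF _ pi_measurable])
      (simp add: finite_permutations countable_finite)
  then show ?thesis
    by (simp add: test_word_def)
qed

lemma guess_in_F2: "guess t y \<in> F2 N"
  by (simp add: test_word_def xor_vec_def F2_def)

text \<open>Adding the hard decision and permuting coordinates are both injective, so distinct
  patterns give distinct guesses. Membership of \<open>y\<close> in the space ensures that
  \<open>\<pi> y\<close> is a permutation.\<close>

lemma guess_inj:
  assumes "y \<in> space (PiM {1..N} (\<lambda>_. borel))"
  shows "inj_on (\<lambda>t. guess t y) {1..T}"
proof (rule inj_onI)
  fix s t assume st: "s \<in> {1..T}" "t \<in> {1..T}" and eq: "guess s y = guess t y"
  have p: "\<pi> y permutes {1..N}"
    using measurable_space[OF pi_measurable assms] by simp
  have "e s i = e t i" for i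
  proof (cases "i \<in> {1..N}")
    case True
    then have j: "\<pi> y i \<in> {1..N}"
      using permutes_in_image[OF p] by simp
    \<comment> \<open>At coordinate \<open>\<pi> y i\<close> the permuted patterns show their
      entries at \<open>i\<close>. Keeping \<open>+\<close> instead of rewriting it to xor lets the
      hard decision cancel.\<close>
    show ?thesis
      using fun_cong[OF eq, of "\<pi> y i"] j permutes_inverses[OF p]
      by (simp add: test_word_def xor_vec_def permute_vec_def del: add_bit_eq_xor)
  next
    case False
    then show ?thesis
      using e_F2[OF st(1)] e_F2[OF st(2)] unfolding F2_def by (metis PiE_arb)
  qed
  then have "e s = e t" by (rule ext)
  then show "s = t"
    by (rule inj_onD[OF e_inj _ st])
qed

lemma likelihood_guess_measurable [measurable]:
  "(\<lambda>y. likelihood q N (guess t y) y) \<in> borel_measurable (PiM {1..N} (\<lambda>_. borel))"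
  by (rule measurable_compose_countable'[OF likelihood_measurable guess_measurable])
    (simp add: finite_F2 countable_finite)

text \<open>The guessed word varies with \<open>y\<close> but always lies in \<open>F2 N\<close>, so
  the sum of all likelihoods dominates.\<close>

lemma likelihood_guess_integrable:
  "integrable (output_space N) (\<lambda>y. likelihood q N (guess t y) y)"
proof (rule Bochner_Integration.integrable_bound)
  show "integrable (output_space N) (\<lambda>y. \<Sum>w\<in>F2 N. likelihood q N w y)"
    by (intro Bochner_Integration.integrable_sum likelihood_integrable)
  show "AE y in output_space N. norm (likelihood q N (guess t y) y) \<le>
      norm (\<Sum>w\<in>F2 N. likelihood q N w y)"
  proof (rule AE_I2)
    fix y
    have "likelihood q N (guess t y) y \<le> (\<Sum>w\<in>F2 N. likelihood q N w y)"
      by (rule member_le_sum[OF guess_in_F2 _ finite_F2]) (rule likelihood_nonneg)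
    then show "norm (likelihood q N (guess t y) y) \<le> norm (\<Sum>w\<in>F2 N. likelihood q N w y)"
      by (simp add: likelihood_nonneg)
  qed
qed measurable

text \<open>The uniform prior cancels from the posterior, leaving the normaliser
  \<open>?Z y\<close>. Averaging over the ensemble produces the output density
  \<open>?Z y / 2 ^ N\<close>, which cancels that normaliser.\<close>

lemma p_hit_eq:
  "p_hit q N K e \<pi> t = (\<integral>y. likelihood q N (guess t y) y \<partial>output_space N) / 2 ^ N"
proof -
  let ?Z = "\<lambda>y. \<Sum>v\<in>F2 N. likelihood q N v y"
  have post: "posterior q N K w y = likelihood q N w y / ?Z y" if "w \<in> F2 N" for w y
    using that K_le
    by (simp add: posterior_def pmf_sent flip: sum_divide_distrib)
  have "p_hit q N K e \<pi> t = (\<integral>x. likelihood q N (guess t (snd x)) (snd x) / ?Z (snd x) \<partial>joint q N K)"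
    unfolding p_hit_def
    by (rule arg_cong[where f = "integral\<^sup>L _"]) (auto simp: post guess_in_F2)
  also have "\<dots> = (\<integral>y. (\<Sum>s\<in>set_pmf (ensemble N K). pmf (ensemble N K) s *
      (likelihood q N (sent s) y * (likelihood q N (guess t y) y / ?Z y))) \<partial>output_space N)"
    by (subst integral_joint[OF K_le])
      (auto intro!: divide_nonneg_nonneg sum_nonneg simp: likelihood_nonneg)
  also have "\<dots> = (\<integral>y. likelihood q N (guess t y) y / 2 ^ N \<partial>output_space N)"
  proof (rule Bochner_Integration.integral_cong[OF refl])
    fix y
    have "(\<Sum>s\<in>set_pmf (ensemble N K). pmf (ensemble N K) s *
        (likelihood q N (sent s) y * (likelihood q N (guess t y) y / ?Z y))) =
        (\<Sum>w\<in>F2 N. likelihood q N w y * (likelihood q N (guess t y) y / ?Z y) *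
          measure_pmf.prob (ensemble N K) {s. sent s = w \<and> True})"
      using sum_pmf_ensemble_sent[OF K_le,
          of "\<lambda>w. likelihood q N w y * (likelihood q N (guess t y) y / ?Z y)" "\<lambda>_. True"]
      by (simp only: of_bool_eq mult_1_right)
    also have "\<dots> = (\<Sum>w\<in>F2 N. likelihood q N w y * (likelihood q N (guess t y) y / ?Z y) / 2 ^ N)"
      using pmf_sent[OF K_le] by (intro sum.cong) (auto simp: pmf_map vimage_def)
    also have "\<dots> = ?Z y * (likelihood q N (guess t y) y / ?Z y) / 2 ^ N"
      by (simp add: sum_distrib_right sum_divide_distrib)
    also have "\<dots> = likelihood q N (guess t y) y / 2 ^ N"
    \<comment> \<open>Where the output density vanishes, so does the likelihood of the guess, and
      the convention \<open>0 / 0 = 0\<close> does no harm.\<close>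
    proof (cases "?Z y = 0")
      case True
      then have "likelihood q N (guess t y) y = 0"
        using guess_in_F2 by (subst (asm) sum_nonneg_eq_0_iff) (auto simp: finite_F2 likelihood_nonneg)
      then show ?thesis by simp
    qed simp
    finally show "(\<Sum>s\<in>set_pmf (ensemble N K). pmf (ensemble N K) s *
        (likelihood q N (sent s) y * (likelihood q N (guess t y) y / ?Z y))) =
        likelihood q N (guess t y) y / 2 ^ N" .
  qed
  finally show ?thesis by simp
qed

section \<open>Stopping events and their probabilities\<close>

text \<open>Test \<open>t\<close> itself is excluded: for \<open>1 \<le> t \<le> T\<close> this is
  the event that the decoder gets as far as performing test \<open>t\<close>.\<close>

definition avoids :: "nat \<Rightarrow> (nat \<Rightarrow> bit) set \<Rightarrow> (nat \<Rightarrow> real) \<Rightarrow> bool" where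
  "avoids t S y \<longleftrightarrow> (\<forall>i\<in>{1..<t}. guess i y \<notin> S)"

lemma num_tests_eq_iff:
  assumes "1 \<le> t" "t < T"
  shows "num_tests q N T e \<pi> S y = t \<longleftrightarrow> avoids t S y \<and> \<not> avoids (t + 1) S y"
proof
  assume num: "num_tests q N T e \<pi> S y = t"
  \<comment> \<open>Since \<open>t < T\<close>, the count cannot be the default value
    \<open>T\<close> of a failed search.\<close>
  then have ex: "\<exists>t\<in>{1..T}. guess t y \<in> S"
    using assms by (metis num_tests_def less_irrefl)
  then have t: "t = (LEAST t. t \<in> {1..T} \<and> guess t y \<in> S)"
    using num by (simp add: num_tests_def)
  have "t \<in> {1..T} \<and> guess t y \<in> S"
    unfolding t by (rule LeastI_ex) (use ex in auto)
  moreover have "guess i y \<notin> S" if "i \<in> {1..<t}" for i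
    using not_less_Least[of i "\<lambda>t. t \<in> {1..T} \<and> guess t y \<in> S"] that assms t by auto
  ultimately show "avoids t S y \<and> \<not> avoids (t + 1) S y"
    using assms by (auto simp: avoids_def)
next
  assume *: "avoids t S y \<and> \<not> avoids (t + 1) S y"
  then obtain i where i: "i \<in> {1..<t + 1}" "guess i y \<in> S" "i \<notin> {1..<t}"
    unfolding avoids_def by blast
  then have "i = t" by simp
  with i have hit: "guess t y \<in> S" by simp
  have "(LEAST t. t \<in> {1..T} \<and> guess t y \<in> S) = t"
  proof (rule Least_equality)
    show "t \<le> s" if "s \<in> {1..T} \<and> guess s y \<in> S" for s
      using * that by (intro leI notI) (auto simp: avoids_def)
  qed (use assms hit in auto)
  then show "num_tests q N T e \<pi> S y = t"
    using hit assms by (auto simp: num_tests_def)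
qed

text \<open>A hit at the last test and a failure give the same count, so only the outcomes of the
  earlier tests matter.\<close>

lemma num_tests_eq_T_iff: "num_tests q N T e \<pi> S y = T \<longleftrightarrow> avoids T S y"
proof (cases "\<exists>t\<in>{1..T}. guess t y \<in> S")
  case True
  define l where "l = (LEAST t. t \<in> {1..T} \<and> guess t y \<in> S)"
  have l: "l \<in> {1..T} \<and> guess l y \<in> S"
    unfolding l_def by (rule LeastI_ex) (use True in auto)
  have min: "guess i y \<notin> S" if "i \<in> {1..<l}" for i
    using not_less_Least[of i "\<lambda>t. t \<in> {1..T} \<and> guess t y \<in> S"] that l by (auto simp: l_def)
  have "num_tests q N T e \<pi> S y = l"
    using True by (simp add: num_tests_def l_def)
  moreover have "l = T \<longleftrightarrow> avoids T S y"
    using l min by (auto simp: avoids_def)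
  ultimately show ?thesis by simp
next
  case False
  then show ?thesis by (auto simp: num_tests_def avoids_def)
qed

text \<open>For a fixed word, membership in the codebook depends on the discrete component alone;
  these predicates are glued over the finitely many values of the guess.\<close>

lemma avoids_measurable [measurable]:
  "Measurable.pred (count_space UNIV \<Otimes>\<^sub>M PiM {1..N} (\<lambda>_. borel))
    (\<lambda>x::((nat \<Rightarrow> bit) list \<times> nat) \<times> (nat \<Rightarrow> real). avoids t (set (fst (fst x))) (snd x))"
proof -
  have "Measurable.pred (count_space UNIV \<Otimes>\<^sub>M PiM {1..N} (\<lambda>_. borel))
      (\<lambda>x::((nat \<Rightarrow> bit) list \<times> nat) \<times> (nat \<Rightarrow> real). guess i (snd x) \<in> set (fst (fst x)))" for i
  proof (rule measurable_compose_countable'[where I = "F2 N" and g = "\<lambda>x. guess i (snd x)"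
        and f = "\<lambda>w x. w \<in> set (fst (fst x))"])
    show "Measurable.pred (count_space UNIV \<Otimes>\<^sub>M PiM {1..N} (\<lambda>_. borel))
        (\<lambda>x::((nat \<Rightarrow> bit) list \<times> nat) \<times> (nat \<Rightarrow> real). w \<in> set (fst (fst x)))" for w
      by (rule measurable_compose[OF measurable_fst]) simp
  qed (auto simp: finite_F2 countable_finite)
  then show ?thesis
    unfolding avoids_def by (intro pred_intros_finite pred_intros_logic) auto
qed

lemma prob_avoids:
  assumes "1 \<le> t" "t \<le> T"
  shows "measure (joint q N K) {x \<in> space (joint q N K). avoids t (set (fst (fst x))) (snd x)} =
    (1 - (\<Sum>i=1..<t. p_hit q N K e \<pi> i)) * (1 - pre_target_hit N K t)"
proof -
  let ?f = "1 - pre_target_hit N K t"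
  let ?A = "\<lambda>y. (\<lambda>i. guess i y) ` {1..<t}"
  have "measure (joint q N K) {x \<in> space (joint q N K). avoids t (set (fst (fst x))) (snd x)} =
      (\<integral>x. indicator {x \<in> space (joint q N K). avoids t (set (fst (fst x))) (snd x)} x \<partial>joint q N K)"
    by simp
  also have "\<dots> = (\<integral>x. of_bool (avoids t (set (fst (fst x))) (snd x)) \<partial>joint q N K)"
    by (intro Bochner_Integration.integral_cong) (auto simp: indicator_def)
  also have "\<dots> = (\<integral>y. (\<Sum>s\<in>set_pmf (ensemble N K). pmf (ensemble N K) s *
      (likelihood q N (sent s) y * of_bool (avoids t (set (fst s)) y))) \<partial>output_space N)"
    by (subst integral_joint[OF K_le]) auto
  also have "\<dots> = (\<integral>y. ((\<Sum>w\<in>F2 N. likelihood q N w y) - (\<Sum>i\<in>{1..<t}. likelihood q N (guess i y) y)) *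
      (?f / 2 ^ N) \<partial>output_space N)"
  proof (rule Bochner_Integration.integral_cong[OF refl])
    fix y assume "y \<in> space (output_space N)"
    then have y: "y \<in> space (PiM {1..N} (\<lambda>_. borel))"
      by (simp add: space_PiM)
    have inj: "inj_on (\<lambda>i. guess i y) {1..<t}"
      by (rule inj_on_subset[OF guess_inj[OF y]]) (use assms in auto)
    have card: "card (?A y) = t - 1"
      by (simp add: card_image[OF inj])
    have sub: "?A y \<subseteq> F2 N"
      by (auto intro: guess_in_F2)
    have avoids_iff: "avoids t S y \<longleftrightarrow> S \<inter> ?A y = {}" for S
      by (auto simp: avoids_def)
    \<comment> \<open>The value is the same for every unguessed \<open>w\<close>, so it factors out
      of the sum over transmitted words.\<close>
    have miss: "measure_pmf.prob (ensemble N K) {s. sent s = w \<and> avoids t (set (fst s)) y} = ?f / 2 ^ N"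
      if "w \<in> F2 N - ?A y" for w
    proof -
      have "{s. sent s = w \<and> avoids t (set (fst s)) y} =
          {(C, m). sent (C, m) = w \<and> set C \<inter> ?A y = {}}"
        by (auto simp: avoids_iff)
      then have "measure_pmf.prob (ensemble N K) {s. sent s = w \<and> avoids t (set (fst s)) y} =
          real (2 ^ N - 1 - (t - 1) choose (2 ^ K - 1)) / (2 ^ N * real (2 ^ N - 1 choose (2 ^ K - 1)))"
        using prob_sent_avoiding[OF K_le sub that] by (simp only: card)
      also have "(2::nat) ^ N - 1 - (t - 1) = 2 ^ N - t"
        using assms by simp
      finally show ?thesis
        using binomial_ratio_pre_target_hit[OF K_le assms(1), symmetric] assms T_le
        by (simp add: field_simps)
    qed
    \<comment> \<open>The transmitted word is always a codeword, so a guess equal to it cannot miss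
      the code.\<close>
    have hit: "measure_pmf.prob (ensemble N K) {s. sent s = w \<and> avoids t (set (fst s)) y} = 0"
      if "w \<in> ?A y" for w
    proof -
      have "set_pmf (ensemble N K) \<inter> {s. sent s = w \<and> avoids t (set (fst s)) y} = {}"
        unfolding avoids_iff using that sent_in_codebook[OF K_le] by blast
      then show ?thesis
        by (simp add: measure_pmf_zero_iff)
    qed
    have "(\<Sum>s\<in>set_pmf (ensemble N K). pmf (ensemble N K) s *
        (likelihood q N (sent s) y * of_bool (avoids t (set (fst s)) y))) =
        (\<Sum>w\<in>F2 N. likelihood q N w y *
          measure_pmf.prob (ensemble N K) {s. sent s = w \<and> avoids t (set (fst s)) y})"
      by (rule sum_pmf_ensemble_sent[OF K_le])
    also have "\<dots> = (\<Sum>w\<in>F2 N - ?A y. likelihood q N w y * (?f / 2 ^ N))"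
      by (rule sum.mono_neutral_cong_right[OF finite_F2])
        (blast, use hit in force, simp only: miss)
    also have "\<dots> = (\<Sum>w\<in>F2 N - ?A y. likelihood q N w y) * (?f / 2 ^ N)"
      by (rule sum_distrib_right[symmetric])
    also have "(\<Sum>w\<in>F2 N - ?A y. likelihood q N w y) =
        (\<Sum>w\<in>F2 N. likelihood q N w y) - (\<Sum>w\<in>?A y. likelihood q N w y)"
      by (rule sum_diff[OF finite_F2 sub])
    \<comment> \<open>Distinctness of the guesses turns the sum over guessed words into a sum over
      test numbers.\<close>
    also have "(\<Sum>w\<in>?A y. likelihood q N w y) = (\<Sum>i\<in>{1..<t}. likelihood q N (guess i y) y)"
      by (simp add: sum.reindex[OF inj])
    finally show "(\<Sum>s\<in>set_pmf (ensemble N K). pmf (ensemble N K) s *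
        (likelihood q N (sent s) y * of_bool (avoids t (set (fst s)) y))) =
        ((\<Sum>w\<in>F2 N. likelihood q N w y) - (\<Sum>i\<in>{1..<t}. likelihood q N (guess i y) y)) *
          (?f / 2 ^ N)" .
  qed
  \<comment> \<open>Each likelihood integrates to one, so the sum over all words contributes their
    number.\<close>
  also have "\<dots> = (real (card (F2 N)) -
      (\<Sum>i\<in>{1..<t}. \<integral>y. likelihood q N (guess i y) y \<partial>output_space N)) * (?f / 2 ^ N)"
    by (subst integral_mult_left_zero, subst Bochner_Integration.integral_diff)
      (auto simp: Bochner_Integration.integral_sum likelihood_integrable
        likelihood_guess_integrable integral_likelihood)
  also have "(\<Sum>i\<in>{1..<t}. \<integral>y. likelihood q N (guess i y) y \<partial>output_space N) =
      2 ^ N * (\<Sum>i=1..<t. p_hit q N K e \<pi> i)"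
    by (simp add: p_hit_eq sum_distrib_left)
  also have "(real (card (F2 N)) - 2 ^ N * (\<Sum>i=1..<t. p_hit q N K e \<pi> i)) * (?f / 2 ^ N) =
      (1 - (\<Sum>i=1..<t. p_hit q N K e \<pi> i)) * ?f"
    by (simp add: card_F2 field_simps)
  finally show ?thesis .
qed

text \<open>The avoidance events decrease in \<open>t\<close>, and stopping at \<open>t\<close> is
  the difference of two consecutive ones. The assumption \<open>t < T\<close> makes
  \<open>prob_avoids\<close> applicable at \<open>t + 1\<close>.\<close>

lemma P_stop_eq:
  assumes "1 \<le> t" "t < T"
  shows "P_stop q N K T e \<pi> t = p_hit q N K e \<pi> t * (1 - pre_target_hit N K t) +
    (1 - (\<Sum>i=1..t. p_hit q N K e \<pi> i)) * (pre_target_hit N K (t + 1) - pre_target_hit N K t)"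
proof -
  interpret J: prob_space "joint q N K" by (rule prob_space_joint)
  let ?E = "\<lambda>t. {x \<in> space (joint q N K). avoids t (set (fst (fst x))) (snd x)}"
  have "{((C, m), y). ((C, m), y) \<in> space (joint q N K) \<and> num_tests q N T e \<pi> (set C) y = t} =
      ?E t - ?E (t + 1)"
    using num_tests_eq_iff[OF assms] by auto
  then have "P_stop q N K T e \<pi> t = measure (joint q N K) (?E t - ?E (t + 1))"
    by (simp add: P_stop_def)
  also have "\<dots> = measure (joint q N K) (?E t) - measure (joint q N K) (?E (t + 1))"
    by (rule J.finite_measure_Diff) (measurable, auto simp: avoids_def)
  also have "\<dots> = (1 - (\<Sum>i=1..<t. p_hit q N K e \<pi> i)) * (1 - pre_target_hit N K t) -
      (1 - (\<Sum>i=1..<t + 1. p_hit q N K e \<pi> i)) * (1 - pre_target_hit N K (t + 1))"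
    using assms by (simp only: prob_avoids)
  also have "(\<Sum>i=1..<t + 1. p_hit q N K e \<pi> i) = (\<Sum>i=1..t. p_hit q N K e \<pi> i)"
    by (rule sum.cong) auto
  \<comment> \<open>Both partial sums are expressed through the sum up to \<open>t\<close>; the
    split-off term supplies the summand \<open>p_hit\<close> times
    \<open>1 - pre_target_hit\<close>.\<close>
  also have "(\<Sum>i=1..<t. p_hit q N K e \<pi> i) =
      (\<Sum>i=1..t. p_hit q N K e \<pi> i) - p_hit q N K e \<pi> t"
    using assms by (simp add: sum.last_plus)
  finally show ?thesis
    by (simp add: algebra_simps)
qed

lemma P_stop_last:
  "P_stop q N K T e \<pi> T = (1 - (\<Sum>i=1..T - 1. p_hit q N K e \<pi> i)) * (1 - pre_target_hit N K T)"
proof -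
  have "{((C, m), y). ((C, m), y) \<in> space (joint q N K) \<and> num_tests q N T e \<pi> (set C) y = T} =
      {x \<in> space (joint q N K). avoids T (set (fst (fst x))) (snd x)}"
    using num_tests_eq_T_iff by auto
  moreover have "{1..<T} = {1..T - 1}"
    using T_pos by auto
  ultimately show ?thesis
    using prob_avoids[of T] T_pos by (simp add: P_stop_def)
qed

end

theorem proposition7:
  fixes N K T :: nat
    and q :: "bit \<Rightarrow> real \<Rightarrow> real"
    and e :: "nat \<Rightarrow> nat \<Rightarrow> bit"
    and \<pi> :: "(nat \<Rightarrow> real) \<Rightarrow> nat \<Rightarrow> nat"
  assumes "K \<le> N" and "1 \<le> T" and "T \<le> 2 ^ N"
    and "\<And>b. q b \<in> borel_measurable borel"
    and "\<And>b x. 0 \<le> q b x"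
    and "\<And>b. (\<integral>\<^sup>+ x. ennreal (q b x) \<partial>lborel) = 1"
    and "\<And>t. t \<in> {1..T} \<Longrightarrow> e t \<in> F2 N"
    and "inj_on e {1..T}"
    and "\<pi> \<in> PiM {1..N} (\<lambda>_. borel) \<rightarrow>\<^sub>M count_space {p. p permutes {1..N}}"
  shows "(\<forall>t\<in>{1..T - 1}. P_stop q N K T e \<pi> t =
            p_hit q N K e \<pi> t * (1 - pre_target_hit N K t) +
            (1 - (\<Sum>i=1..t. p_hit q N K e \<pi> i)) *
              (pre_target_hit N K (t + 1) - pre_target_hit N K t)) \<and>
         P_stop q N K T e \<pi> T =
           (1 - (\<Sum>i=1..T - 1. p_hit q N K e \<pi> i)) * (1 - pre_target_hit N K T)"
proof -
  interpret orb_grand q N K T e \<pi>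
    by (unfold_locales) (use assms in auto)
  show ?thesis
    using P_stop_eq P_stop_last by auto
qed

end
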